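(* Let $A$ be a $C^*$-algebra, and let $a, b\in A$ be regular elements such that $ab$ is also regular. Define $p = bb^{\dagger}$, $q = a^{\dagger}(a^{\dagger})^{*}$, $r = bb^*$ and $s = a^{\dagger}a$. Then the following statements are equivalent: (i) $(ab)^{\dagger} = b^{\dagger}a^{\dagger}$; (ii) $b^{\dagger}(qp-pq)a^*=0$ and $b^{\dagger}(sr-rs)a^*=0$; (iii) $pqps = pq$ and $psrs = rs$.
   Context: An element $a$ of a $C^*$-algebra $A$ is called regular if there is $a'\in A$ with $a = aa'a$. Every regular element $a$ of a $C^*$-algebra has a unique Moore-Penrose inverse, denoted $a^{\dagger}$: the unique $x\in A$ with $a=axa$, $x=xax$, $(ax)^*=ax$, $(xa)^*=xa$. *)

theory Defs
  imports "HOL-Analysis.Analysis"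
begin

text \<open>
  The distribution has real normed algebras only, so the complex structure is added here.
  The algebra is not assumed to have a unit: \<^class>\<open>real_normed_algebra\<close> provides an associative
  algebra with submultiplicative norm, and \<^class>\<open>banach\<close> provides completeness. The law
  for \<open>scaleR_scaleC\<close> makes the real structure the restriction of the complex one.
\<close>

class cstar_algebra = real_normed_algebra + banach +
  fixes scaleC :: "complex \<Rightarrow> 'a \<Rightarrow> 'a"  (infixr "*\<^sub>C" 75)
    and adj :: "'a \<Rightarrow> 'a"  ("_\<^sup>\<star>" [1000] 1000)
  assumes scaleR_scaleC: "scaleR t x = complex_of_real t *\<^sub>C x"
    and scaleC_add_right: "c *\<^sub>C (x + y) = c *\<^sub>C x + c *\<^sub>C y"
    and scaleC_add_left: "(c + d) *\<^sub>C x = c *\<^sub>C x + d *\<^sub>C x"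
    and scaleC_scaleC: "c *\<^sub>C (d *\<^sub>C x) = (c * d) *\<^sub>C x"
    and mult_scaleC_left: "(c *\<^sub>C x) * y = c *\<^sub>C (x * y)"
    and mult_scaleC_right: "x * (c *\<^sub>C y) = c *\<^sub>C (x * y)"
    and norm_scaleC: "norm (c *\<^sub>C x) = cmod c * norm x"
    and adj_adj: "(x\<^sup>\<star>)\<^sup>\<star> = x"
    and adj_add: "(x + y)\<^sup>\<star> = x\<^sup>\<star> + y\<^sup>\<star>"
    and adj_scaleC: "(c *\<^sub>C x)\<^sup>\<star> = cnj c *\<^sub>C x\<^sup>\<star>"
    and adj_mult: "(x * y)\<^sup>\<star> = y\<^sup>\<star> * x\<^sup>\<star>"
    and norm_adj_mult_self: "norm (x\<^sup>\<star> * x) = (norm x)\<^sup>2"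

definition regular :: "'a::cstar_algebra \<Rightarrow> bool" where
  "regular a \<longleftrightarrow> (\<exists>a'. a = a * a' * a)"

definition is_mp_inverse :: "'a::cstar_algebra \<Rightarrow> 'a \<Rightarrow> bool" where
  "is_mp_inverse a x \<longleftrightarrow>
     a = a * x * a \<and> x = x * a * x \<and> (a * x)\<^sup>\<star> = a * x \<and> (x * a)\<^sup>\<star> = x * a"

definition mp_inverse :: "'a::cstar_algebra \<Rightarrow> 'a"  ("_\<^sup>\<dagger>" [1000] 1000) where
  "a\<^sup>\<dagger> = (THE x. is_mp_inverse a x)"

lemma is_mp_inverse_unique:
  fixes a x y :: "'a::cstar_algebra"
  assumes x: "is_mp_inverse a x" and y: "is_mp_inverse a y"
  shows "x = y"
proof -
  have ax: "a * x = a * y"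
  proof -
    have "a * x = (a * y) * (a * x)"
      using y unfolding is_mp_inverse_def by (metis mult.assoc)
    also have "\<dots> = ((a * x) * (a * y))\<^sup>\<star>"
      using x y unfolding is_mp_inverse_def by (simp add: adj_mult)
    also have "(a * x) * (a * y) = a * y"
      using x unfolding is_mp_inverse_def by (metis mult.assoc)
    finally show ?thesis
      using y unfolding is_mp_inverse_def by simp
  qed
  have xa: "x * a = y * a"
  proof -
    have "x * a = (x * a) * (y * a)"
      using y unfolding is_mp_inverse_def by (metis mult.assoc)
    also have "\<dots> = ((y * a) * (x * a))\<^sup>\<star>"
      using x y unfolding is_mp_inverse_def by (simp add: adj_mult)
    also have "(y * a) * (x * a) = y * a"
      using x unfolding is_mp_inverse_def by (metis mult.assoc)
    finally show ?thesis
      using y unfolding is_mp_inverse_def by simp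
  qed
  have "x = x * a * x" and "y = y * a * y"
    using x y unfolding is_mp_inverse_def by blast+
  then show ?thesis
    using ax xa by (metis mult.assoc)
qed

lemma mp_inverse_eqI: "is_mp_inverse a x \<Longrightarrow> a\<^sup>\<dagger> = x"
  unfolding mp_inverse_def by (blast intro: the_equality is_mp_inverse_unique)

end

theory Submission
  imports Defs
begin

text \<open>
  Write \<open>a'\<close>, \<open>b'\<close> for the Moore-Penrose inverses of \<open>a\<close>, \<open>b\<close>. Everything is controlled by the two
  elements \<open>d = a p a'\<close> and \<open>f = b' s b\<close>, which are \<open>(ab)(b'a')\<close> and \<open>(b'a')(ab)\<close>. The Penrose
  equations for \<open>b'a'\<close> say that \<open>d\<close> and \<open>f\<close> are self-adjoint and that the projections \<open>p\<close> and \<open>s\<close>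
  commute (\<open>mp_inverse_mult_iff\<close>). On the other hand, multiplying the two equations in (iii) by
  suitable outer factors turns them into \<open>d d\<^sup>\<star> = d\<close> and \<open>f f\<^sup>\<star> = f\<^sup>\<star>\<close>, that is, into \<open>d\<close> and \<open>f\<close> being
  projections. If \<open>p\<close> and \<open>s\<close> commute,
  then \<open>d\<close> and \<open>f\<close> are idempotent; conversely, idempotence of \<open>d\<close> gives \<open>s p s p s = s p s\<close>, and the
  C*-identity makes \<open>p\<close> and \<open>s\<close> commute. Hence (i) and (iii) are equivalent
  (\<open>mp_inverse_mult_iff_products\<close>). Finally (ii) is (iii) multiplied by \<open>b'\<close> on the left and by
  \<open>a\<^sup>\<star>\<close> on the right, and these factors can be cancelled (\<open>commutator_form_iff\<close>).

  To speak about \<open>a\<^sup>\<dagger>\<close> at all, one needs that regular elements have Moore-Penrose inverses. From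
  \<open>a = a x a\<close> one has the idempotent \<open>e = a x\<close>, and one wants the projection \<open>u\<close> with
  \<open>u e = e\<close> and \<open>e u = u\<close>. Such a \<open>u\<close> must satisfy \<open>u (1 + e - e\<^sup>\<star>) = e\<close>, and \<open>1 + k\<close> is invertible for
  every skew-adjoint \<open>k\<close>, since the spectrum of \<open>k\<close> is imaginary. In the absence of a unit,
  invertibility of \<open>1 + k\<close> is replaced by bijectivity of the map \<open>y \<mapsto> y + k y\<close> of the algebra, which
  follows from Banach's fixed point theorem.
\<close>

section \<open>Algebra with the involution\<close>

lemma adj_zero: "(0::'a::cstar_algebra)\<^sup>\<star> = 0"
  by (metis adj_add add_cancel_right_right)

lemma adj_minus: "(- x)\<^sup>\<star> = - (x\<^sup>\<star>)" for x :: "'a::cstar_algebra"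
  by (metis adj_add adj_zero add.right_inverse add_eq_0_iff)

lemma adj_diff: "(x - y)\<^sup>\<star> = x\<^sup>\<star> - y\<^sup>\<star>" for x y :: "'a::cstar_algebra"
  using adj_add[of x "- y"] by (simp add: adj_minus)

lemma adj_scaleR: "(t *\<^sub>R x)\<^sup>\<star> = t *\<^sub>R x\<^sup>\<star>" for x :: "'a::cstar_algebra"
  by (simp add: scaleR_scaleC adj_scaleC)

lemma adj_mult_self_eq_0: "x\<^sup>\<star> * x = 0 \<longleftrightarrow> x = 0" for x :: "'a::cstar_algebra"
  using norm_adj_mult_self[of x] by auto

lemma norm_adj_le: "norm (x\<^sup>\<star>) \<le> norm x" for x :: "'a::cstar_algebra"
proof (cases "x\<^sup>\<star> = 0")
  case False
  have "(norm (x\<^sup>\<star>))\<^sup>2 = norm (x * x\<^sup>\<star>)"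
    using norm_adj_mult_self[of "x\<^sup>\<star>"] by (simp add: adj_adj)
  also have "\<dots> \<le> norm x * norm (x\<^sup>\<star>)"
    by (rule norm_mult_ineq)
  finally show ?thesis
    using False by (simp add: power2_eq_square)
qed simp

lemma self_adjoint_if_eq_mult_adj:
  fixes d :: "'a::cstar_algebra"
  assumes "d = d * d\<^sup>\<star>"
  shows "d\<^sup>\<star> = d"
  by (metis assms adj_mult adj_adj)

text \<open>
  The defect \<open>x = p s - s p s\<close> of commutation satisfies \<open>x\<^sup>\<star> x = s p s - s p s p s\<close>, so that it
  vanishes by the C*-identity.
\<close>

lemma projections_commute:
  fixes p s :: "'a::cstar_algebra"
  assumes p: "p\<^sup>\<star> = p" "p * p = p" and s: "s\<^sup>\<star> = s" "s * s = s"
    and idem: "s * p * s * p * s = s * p * s"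
  shows "s * p = p * s"
proof -
  have p': "p * (p * z) = p * z" and s': "s * (s * z) = s * z" for z
    using p s by (simp_all flip: mult.assoc)
  have "(p * s - s * p * s)\<^sup>\<star> * (p * s - s * p * s) = 0"
    using idem by (simp add: adj_diff adj_mult p s p' s' mult.assoc algebra_simps)
  then have "p * s = s * p * s"
    by (simp add: adj_mult_self_eq_0)
  then show ?thesis
    by (metis adj_mult mult.assoc p(1) s(1))
qed

section \<open>Existence of Moore-Penrose inverses\<close>

text \<open>
  Both summands are compared through their adjoints: \<open>y\<^sup>\<star> y\<close> is self-adjoint and \<open>y\<^sup>\<star> k y\<close> is
  skew-adjoint, so that \<open>y + k y = 0\<close> forces \<open>y\<^sup>\<star> y\<close> to be its own negative.
\<close>

lemma one_plus_skew_injective: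
  fixes k y :: "'a::cstar_algebra"
  assumes k: "k\<^sup>\<star> = - k" and y: "y + k * y = 0"
  shows "y = 0"
proof -
  have 1: "y\<^sup>\<star> * y + y\<^sup>\<star> * (k * y) = 0"
    using y by (metis distrib_left mult_zero_right)
  have "(y\<^sup>\<star> * y + y\<^sup>\<star> * (k * y))\<^sup>\<star> = y\<^sup>\<star> * y - y\<^sup>\<star> * (k * y)"
    by (simp add: adj_add adj_mult adj_adj k mult.assoc)
  with 1 have "y\<^sup>\<star> * y = y\<^sup>\<star> * (k * y)"
    by (simp add: adj_zero)
  with 1 have "2 *\<^sub>R (y\<^sup>\<star> * y) = 0"
    by (simp add: scaleR_2)
  then show ?thesis
    by (simp add: adj_mult_self_eq_0)
qed

text \<open>
  This is the estimate by which one shows that self-adjoint elements have real spectrum, with the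
  adjoined unit applied to a vector \<open>y\<close>. For large \<open>t\<close> the right-hand factor is smaller than
  \<open>(1 + t)\<^sup>2\<close>.
\<close>

lemma norm_shifted_skew:
  fixes k y :: "'a::cstar_algebra"
  assumes k: "k\<^sup>\<star> = - k"
  shows "(norm (t *\<^sub>R y - k * y))\<^sup>2 \<le> (t\<^sup>2 + (norm k)\<^sup>2) * (norm y)\<^sup>2"
proof -
  have "(norm (t *\<^sub>R y - k * y))\<^sup>2 = norm ((t *\<^sub>R y - k * y)\<^sup>\<star> * (t *\<^sub>R y - k * y))"
    by (simp add: norm_adj_mult_self)
  also have "(t *\<^sub>R y - k * y)\<^sup>\<star> * (t *\<^sub>R y - k * y) = y\<^sup>\<star> * (t\<^sup>2 *\<^sub>R y - k * (k * y))"
    by (simp add: adj_diff adj_scaleR adj_mult k power2_eq_square algebra_simps)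
  also have "norm \<dots> \<le> norm y * (t\<^sup>2 * norm y + norm k * (norm k * norm y))"
  proof -
    have "norm (k * (k * y)) \<le> norm k * (norm k * norm y)"
      by (meson norm_mult_ineq mult_left_mono norm_ge_zero order_trans)
    then have "norm (t\<^sup>2 *\<^sub>R y - k * (k * y)) \<le> t\<^sup>2 * norm y + norm k * (norm k * norm y)"
      using norm_triangle_ineq4[of "t\<^sup>2 *\<^sub>R y" "k * (k * y)"] by simp
    then show ?thesis
      using norm_mult_ineq[of "y\<^sup>\<star>"] norm_adj_le[of y]
      by (meson mult_mono norm_ge_zero order_trans)
  qed
  finally show ?thesis
    by (simp add: power2_eq_square algebra_simps)
qed

text \<open>
  After adding \<open>t y\<close> on both sides, the equation reads \<open>(1 + t) y = c + (t y - k y)\<close>, and the previous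
  estimate makes its right-hand side, divided by \<open>1 + t\<close>, a contraction in \<open>y\<close>.
\<close>

lemma one_plus_skew_surjective:
  fixes k c :: "'a::cstar_algebra"
  assumes k: "k\<^sup>\<star> = - k"
  obtains y where "y + k * y = c"
proof -
  \<comment> \<open>For this \<open>t\<close> the bound \<open>t\<^sup>2 + (norm k)\<^sup>2 = t (t + 1)\<close> is below \<open>(1 + t)\<^sup>2\<close>.\<close>
  define t where "t = (norm k)\<^sup>2"
  define F where "F y = (1 / (1 + t)) *\<^sub>R (c + (t *\<^sub>R y - k * y))" for y
  define L where "L = sqrt (t / (1 + t))"
  have t: "t \<ge> 0"
    by (simp add: t_def)
  have L: "0 \<le> L" "L < 1"
    using t by (auto simp: L_def real_sqrt_lt_1_iff)
  have "dist (F x) (F y) \<le> L * dist x y" for x y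
  proof -
    define v where "v = t *\<^sub>R (x - y) - k * (x - y)"
    have "F x - F y = (1 / (1 + t)) *\<^sub>R v"
      by (simp add: F_def v_def algebra_simps)
    then have "(norm (F x - F y))\<^sup>2 = (norm v)\<^sup>2 / (1 + t)\<^sup>2"
      using t by (simp add: power_divide)
    also have "\<dots> \<le> (t\<^sup>2 + t) * (norm (x - y))\<^sup>2 / (1 + t)\<^sup>2"
      using norm_shifted_skew[OF k, of t "x - y"]
      by (intro divide_right_mono) (simp_all add: v_def t_def)
    also have "\<dots> = t / (1 + t) * (norm (x - y))\<^sup>2"
    proof -
      have "(t\<^sup>2 + t) / (1 + t)\<^sup>2 = t * (1 + t) / ((1 + t) * (1 + t))"
        by (simp add: power2_eq_square distrib_left add.commute)
      also have "\<dots> = t / (1 + t)"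
        using t by (intro nonzero_mult_divide_mult_cancel_right) simp
      finally show ?thesis
        by (simp only: times_divide_eq_left[symmetric])
    qed
    also have "\<dots> = (L * norm (x - y))\<^sup>2"
      using t by (simp add: L_def power_mult_distrib)
    finally have "norm (F x - F y) \<le> L * norm (x - y)"
      by (rule power2_le_imp_le) (simp add: L)
    then show ?thesis
      by (simp add: dist_norm)
  qed
  then have "\<exists>!y. F y = y"
    using L by (intro banach_fix_type[where c = L]) auto
  then obtain y where "F y = y"
    by blast
  then have "(1 + t) *\<^sub>R y = (1 + t) *\<^sub>R F y"
    by simp
  also have "\<dots> = c + (t *\<^sub>R y - k * y)"
    using t by (simp add: F_def)
  finally have "y + k * y = c"
    by (simp add: algebra_simps)
  then show thesis
    by (rule that)
qed

text \<open>
  The projection onto the range of \<open>e\<close> is \<open>e (1 + e - e\<^sup>\<star>)\<^sup>-\<^sup>1\<close>. Its adjoint is obtained by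
  solving \<open>w + k w = e\<^sup>\<star>\<close> with \<open>k = e\<^sup>\<star> - e\<close>; the identities \<open>w e = e\<close> and \<open>w e\<^sup>\<star> = w\<close> hold because
  both sides solve the same equation.
\<close>

lemma range_projection:
  fixes e :: "'a::cstar_algebra"
  assumes e: "e * e = e"
  obtains u where "u\<^sup>\<star> = u" and "e * u = u" and "u * e = e"
proof -
  define k where "k = e\<^sup>\<star> - e"
  have k: "k\<^sup>\<star> = - k"
    by (simp add: k_def adj_diff adj_adj)
  obtain w where w: "w + k * w = e\<^sup>\<star>"
    using one_plus_skew_surjective[OF k] by blast
  have inj: "x = y" if "x + k * x = y + k * y" for x y
    using one_plus_skew_injective[OF k, of "x - y"] that by (simp add: algebra_simps)
  have we: "w * e = e"
  proof (rule inj)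
    have "w * e + k * (w * e) = (w + k * w) * e"
      by (simp add: algebra_simps)
    also have "\<dots> = e + k * e"
      unfolding w by (simp add: k_def algebra_simps e)
    finally show "w * e + k * (w * e) = e + k * e" .
  qed
  have we': "w * e\<^sup>\<star> = w"
  proof (rule inj)
    have "w * e\<^sup>\<star> + k * (w * e\<^sup>\<star>) = (w + k * w) * e\<^sup>\<star>"
      by (simp add: algebra_simps)
    also have "\<dots> = w + k * w"
      unfolding w by (metis adj_mult e)
    finally show "w * e\<^sup>\<star> + k * (w * e\<^sup>\<star>) = w + k * w" .
  qed
  have ew: "e * w\<^sup>\<star> = w\<^sup>\<star>"
    by (metis we' adj_mult adj_adj)
  have "w * w\<^sup>\<star> = w\<^sup>\<star>"
    by (metis ew we mult.assoc)
  then have "w\<^sup>\<star> = w"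
    by (metis adj_mult adj_adj)
  with ew we show thesis
    by (intro that[of w]) auto
qed

lemma regular_imp_self_adjoint_range:
  fixes a :: "'a::cstar_algebra"
  assumes "regular a"
  obtains y where "(a * y)\<^sup>\<star> = a * y" and "a * y * a = a"
proof -
  obtain x where x: "a = a * x * a"
    using assms by (auto simp: regular_def)
  then have "(a * x) * (a * x) = a * x"
    by (metis mult.assoc)
  then obtain u where u: "u\<^sup>\<star> = u" "a * x * u = u" "u * (a * x) = a * x"
    by (rule range_projection)
  have "u * a = a"
    by (metis u(3) x mult.assoc)
  with u show thesis
    by (intro that[of "x * u"]) (simp_all flip: mult.assoc)
qed

lemma regular_adj:
  assumes "regular a"
  shows "regular (a\<^sup>\<star>)"
  using assms unfolding regular_def by (metis adj_mult mult.assoc)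

text \<open>
  An inner inverse \<open>y\<close> with \<open>a y\<close> self-adjoint and an inner inverse \<open>z\<close> with \<open>z a\<close> self-adjoint
  combine to the Moore-Penrose inverse \<open>z a y\<close>; the second comes from the adjoint of \<open>a\<close>.
\<close>

lemma regular_imp_mp_inverse:
  fixes a :: "'a::cstar_algebra"
  assumes "regular a"
  shows "is_mp_inverse a (a\<^sup>\<dagger>)"
proof -
  obtain y where y: "(a * y)\<^sup>\<star> = a * y" "a * y * a = a"
    using assms by (rule regular_imp_self_adjoint_range)
  obtain v where v: "(a\<^sup>\<star> * v)\<^sup>\<star> = a\<^sup>\<star> * v" "a\<^sup>\<star> * v * a\<^sup>\<star> = a\<^sup>\<star>"
    using regular_adj[OF assms] by (rule regular_imp_self_adjoint_range)
  define z where "z = v\<^sup>\<star>"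
  have z: "(z * a)\<^sup>\<star> = z * a" "a * z * a = a"
    using v unfolding z_def by (metis adj_mult adj_adj mult.assoc)+
  have ax: "a * (z * a * y) = a * y" and xa: "(z * a * y) * a = z * a"
    using y(2) z(2) by (metis mult.assoc)+
  have "is_mp_inverse a (z * a * y)"
    unfolding is_mp_inverse_def ax xa using y z
    by (metis mult.assoc)
  then show ?thesis
    using mp_inverse_eqI by metis
qed

section \<open>The reverse order law\<close>

text \<open>
  The Penrose equations and their adjoints, as rewrite rules for right-associated products in
  \<open>a\<close>, its Moore-Penrose inverse and their adjoints. The two products of adjoints are
  turned into the range projections, so that these words have a common normal form.
\<close>

lemma mp_inverse_rewrites:
  fixes a x :: "'a::cstar_algebra"
  assumes "is_mp_inverse a x"
  shows "a * (x * a) = a" "x * (a * x) = x"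
    "a\<^sup>\<star> * x\<^sup>\<star> = x * a" "x\<^sup>\<star> * a\<^sup>\<star> = a * x"
    "a * (x * x\<^sup>\<star>) = x\<^sup>\<star>" "x * (a * a\<^sup>\<star>) = a\<^sup>\<star>"
    "a\<^sup>\<star> * (a * x) = a\<^sup>\<star>" "x\<^sup>\<star> * (x * a) = x\<^sup>\<star>"
    "a * (x * (a * z)) = a * z" "x * (a * (x * z)) = x * z"
    "a\<^sup>\<star> * (x\<^sup>\<star> * z) = x * (a * z)" "x\<^sup>\<star> * (a\<^sup>\<star> * z) = a * (x * z)"
    "a * (x * (x\<^sup>\<star> * z)) = x\<^sup>\<star> * z" "x * (a * (a\<^sup>\<star> * z)) = a\<^sup>\<star> * z"
    "a\<^sup>\<star> * (a * (x * z)) = a\<^sup>\<star> * z" "x\<^sup>\<star> * (x * (a * z)) = x\<^sup>\<star> * z"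
proof -
  note mp = assms[unfolded is_mp_inverse_def]
  show *: "a * (x * a) = a" "x * (a * x) = x"
    "a\<^sup>\<star> * x\<^sup>\<star> = x * a" "x\<^sup>\<star> * a\<^sup>\<star> = a * x"
    using mp by (metis mult.assoc adj_mult)+
  show **: "a * (x * x\<^sup>\<star>) = x\<^sup>\<star>" "x * (a * a\<^sup>\<star>) = a\<^sup>\<star>"
    "a\<^sup>\<star> * (a * x) = a\<^sup>\<star>" "x\<^sup>\<star> * (x * a) = x\<^sup>\<star>"
    using mp by (metis mult.assoc adj_mult)+
  show "a * (x * (a * z)) = a * z" "x * (a * (x * z)) = x * z"
    "a\<^sup>\<star> * (x\<^sup>\<star> * z) = x * (a * z)" "x\<^sup>\<star> * (a\<^sup>\<star> * z) = a * (x * z)"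
    "a * (x * (x\<^sup>\<star> * z)) = x\<^sup>\<star> * z" "x * (a * (a\<^sup>\<star> * z)) = a\<^sup>\<star> * z"
    "a\<^sup>\<star> * (a * (x * z)) = a\<^sup>\<star> * z" "x\<^sup>\<star> * (x * (a * z)) = x\<^sup>\<star> * z"
    by (fact * [THEN arg_cong[where f = "\<lambda>w. w * z"], unfolded mult.assoc]
        ** [THEN arg_cong[where f = "\<lambda>w. w * z"], unfolded mult.assoc])+
qed

text \<open>
  The first two Penrose equations for \<open>b' a'\<close> amount to \<open>p\<close> and \<open>s\<close> commuting: cancelling the outer
  factors in \<open>a p s b = a b\<close> leaves \<open>s p s p = s p\<close>.
\<close>

lemma mp_inverse_mult_iff:
  fixes a b a' b' :: "'a::cstar_algebra"
  assumes a: "is_mp_inverse a a'" and b: "is_mp_inverse b b'"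
  defines "p \<equiv> b * b'" and "s \<equiv> a' * a"
  shows "is_mp_inverse (a * b) (b' * a') \<longleftrightarrow>
    (a * p * a')\<^sup>\<star> = a * p * a' \<and> (b' * s * b)\<^sup>\<star> = b' * s * b \<and> s * p = p * s"
proof
  note rules = mp_inverse_rewrites[OF a] mp_inverse_rewrites[OF b] adj_mult adj_adj
  assume mp: "is_mp_inverse (a * b) (b' * a')"
  have "a' * (a * b * (b' * a') * (a * b)) * b' = a' * (a * b) * b'"
    using mp by (simp add: is_mp_inverse_def)
  then have "s * p * s * p = s * p"
    by (simp add: p_def s_def mult.assoc)
  then have "s * p = p * s"
    by (intro projections_commute) (simp_all add: p_def s_def mult.assoc rules)
  then show "(a * p * a')\<^sup>\<star> = a * p * a' \<and> (b' * s * b)\<^sup>\<star> = b' * s * b \<and> s * p = p * s"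
    using mp by (simp add: is_mp_inverse_def p_def s_def mult.assoc)
next
  note rules = mp_inverse_rewrites[OF a] mp_inverse_rewrites[OF b]
  assume R: "(a * p * a')\<^sup>\<star> = a * p * a' \<and> (b' * s * b)\<^sup>\<star> = b' * s * b \<and> s * p = p * s"
  have "a * b * (b' * a') * (a * b) = a * (p * s) * b"
    by (simp add: p_def s_def mult.assoc)
  also have "\<dots> = a * (s * p) * b"
    using R by simp
  also have "\<dots> = a * b"
    by (simp add: p_def s_def mult.assoc rules)
  finally have 1: "a * b * (b' * a') * (a * b) = a * b" .
  have "b' * a' * (a * b) * (b' * a') = b' * (s * p) * a'"
    by (simp add: p_def s_def mult.assoc)
  also have "\<dots> = b' * (p * s) * a'"
    using R by simp
  also have "\<dots> = b' * a'"
    by (simp add: p_def s_def mult.assoc rules)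
  finally have 2: "b' * a' * (a * b) * (b' * a') = b' * a'" .
  show "is_mp_inverse (a * b) (b' * a')"
    using R 1 2 by (simp add: is_mp_inverse_def p_def s_def mult.assoc)
qed

text \<open>
  Both sides say that \<open>d = a p a'\<close> and \<open>f = b' s b\<close> are projections: multiplying the two equations
  on the right-hand side by suitable outer factors gives \<open>d d\<^sup>\<star> = d\<close> and \<open>f f\<^sup>\<star> = f\<^sup>\<star>\<close>. Undoing this
  multiplication loses a factor \<open>s\<close> or \<open>p\<close>, which is restored once \<open>s\<close> and \<open>p\<close> commute.
\<close>

lemma mp_inverse_mult_iff_products:
  fixes a b a' b' :: "'a::cstar_algebra"
  assumes a: "is_mp_inverse a a'" and b: "is_mp_inverse b b'"
  defines "p \<equiv> b * b'" and "q \<equiv> a' * a'\<^sup>\<star>" and "r \<equiv> b * b\<^sup>\<star>" and "s \<equiv> a' * a"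
  shows "is_mp_inverse (a * b) (b' * a') \<longleftrightarrow> p * q * p * s = p * q \<and> p * s * r * s = r * s"
proof -
  note rules = mp_inverse_rewrites[OF a] mp_inverse_rewrites[OF b] adj_mult adj_adj
  note defs = p_def q_def r_def s_def mult.assoc
  define d where "d = a * p * a'"
  define f where "f = b' * s * b"
  have iff: "is_mp_inverse (a * b) (b' * a') \<longleftrightarrow> d\<^sup>\<star> = d \<and> f\<^sup>\<star> = f \<and> s * p = p * s"
    unfolding d_def f_def p_def s_def by (rule mp_inverse_mult_iff[OF a b])
  show ?thesis
    unfolding iff
  proof (intro iffI conjI; elim conjE)
    assume eq: "p * q * p * s = p * q" "p * s * r * s = r * s"
    have "a * (p * q * p * s) * a\<^sup>\<star> = d * d\<^sup>\<star>" "a * (p * q) * a\<^sup>\<star> = d"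
      by (simp_all add: d_def defs rules)
    then have d: "d = d * d\<^sup>\<star>"
      using eq by simp
    then show d_adj: "d\<^sup>\<star> = d"
      by (rule self_adjoint_if_eq_mult_adj)
    have "b' * (p * s * r * s) * b'\<^sup>\<star> = f * f\<^sup>\<star>" "b' * (r * s) * b'\<^sup>\<star> = f\<^sup>\<star>"
      by (simp_all add: f_def defs rules)
    then have "f\<^sup>\<star> = f * f\<^sup>\<star>"
      using eq by simp
    then show "f\<^sup>\<star> = f"
      by (metis adj_mult adj_adj)
    have "s * p * s * p * s = a' * (d * d) * a"
      by (simp add: d_def defs)
    also have "\<dots> = a' * d * a"
      using d d_adj by simp
    also have "\<dots> = s * p * s"
      by (simp add: d_def defs)
    finally show "s * p = p * s"
      by (intro projections_commute) (simp_all add: defs rules)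
  next
    assume R: "d\<^sup>\<star> = d" "f\<^sup>\<star> = f" "s * p = p * s"
    have "d * d = a * p * (s * p) * a'"
      by (simp add: d_def defs)
    also have "\<dots> = a * p * (p * s) * a'"
      using R by simp
    also have "\<dots> = d"
      by (simp add: d_def defs rules)
    finally have d: "d * d\<^sup>\<star> = d"
      using R by simp
    have "p * q * p * s = (p * s) * q * p * s"
      by (simp add: defs rules)
    also have "\<dots> = (s * p) * q * p * s"
      using R by simp
    also have "\<dots> = a' * (d * d\<^sup>\<star>) * a'\<^sup>\<star>"
      by (simp add: d_def defs rules)
    also have "\<dots> = (s * p) * q"
      unfolding d by (simp add: d_def defs)
    also have "\<dots> = (p * s) * q"
      using R by simp
    also have "\<dots> = p * q"
      by (simp add: defs rules)
    finally show "p * q * p * s = p * q" .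
  next
    assume R: "d\<^sup>\<star> = d" "f\<^sup>\<star> = f" "s * p = p * s"
    have "f * f = b' * (s * p) * s * b"
      by (simp add: f_def defs)
    also have "\<dots> = b' * (p * s) * s * b"
      using R by simp
    also have "\<dots> = f"
      by (simp add: f_def defs rules)
    finally have f: "f * f\<^sup>\<star> = f\<^sup>\<star>"
      using R by simp
    have "p * s * r * s = p * s * r * (p * s)"
      by (simp add: defs rules)
    also have "\<dots> = p * s * r * (s * p)"
      using R by simp
    also have "\<dots> = b * (f * f\<^sup>\<star>) * b\<^sup>\<star>"
      by (simp add: f_def defs rules)
    also have "\<dots> = r * (s * p)"
      unfolding f by (simp add: f_def defs rules)
    also have "\<dots> = r * (p * s)"
      using R by simp
    also have "\<dots> = r * s"
      by (simp add: defs rules)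
    finally show "p * s * r * s = r * s" .
  qed
qed

text \<open>
  Since \<open>b' p = b'\<close> and \<open>s a\<^sup>\<star> = a\<^sup>\<star>\<close>, the outer factors \<open>b'\<close> and \<open>a\<^sup>\<star>\<close> carry the same information as
  \<open>p\<close> and \<open>s\<close>: multiplication by \<open>b\<close> and \<open>a'\<^sup>\<star>\<close> passes from the former to the latter.
\<close>

lemma outer_factors_cancel:
  fixes a b a' b' :: "'a::cstar_algebra"
  assumes a: "is_mp_inverse a a'" and b: "is_mp_inverse b b'"
  shows "b' * x * a\<^sup>\<star> = 0 \<longleftrightarrow> (b * b') * x * (a' * a) = 0"
proof -
  note rules = mp_inverse_rewrites[OF a] mp_inverse_rewrites[OF b]
  have "(b * b') * x * (a' * a) = b * (b' * x * a\<^sup>\<star>) * a'\<^sup>\<star>"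
    by (simp add: mult.assoc rules)
  moreover have "b' * x * a\<^sup>\<star> = b' * ((b * b') * x * (a' * a)) * a\<^sup>\<star>"
    by (simp add: mult.assoc rules)
  ultimately show ?thesis
    by (metis mult_zero_left mult_zero_right)
qed

lemma commutator_form_iff:
  fixes a b a' b' :: "'a::cstar_algebra"
  assumes a: "is_mp_inverse a a'" and b: "is_mp_inverse b b'"
  defines "p \<equiv> b * b'" and "q \<equiv> a' * a'\<^sup>\<star>" and "r \<equiv> b * b\<^sup>\<star>" and "s \<equiv> a' * a"
  shows "b' * (q * p - p * q) * a\<^sup>\<star> = 0 \<longleftrightarrow> p * q * p * s = p * q"
    and "b' * (s * r - r * s) * a\<^sup>\<star> = 0 \<longleftrightarrow> p * s * r * s = r * s"
proof -
  note rules = mp_inverse_rewrites[OF a] mp_inverse_rewrites[OF b]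
  have "p * (q * p - p * q) * s = p * q * p * s - p * q"
    by (simp add: p_def q_def s_def rules algebra_simps)
  then show "b' * (q * p - p * q) * a\<^sup>\<star> = 0 \<longleftrightarrow> p * q * p * s = p * q"
    unfolding outer_factors_cancel[OF a b] by (simp add: p_def s_def)
  have "p * (s * r - r * s) * s = p * s * r * s - r * s"
    by (simp add: p_def r_def s_def rules algebra_simps)
  then show "b' * (s * r - r * s) * a\<^sup>\<star> = 0 \<longleftrightarrow> p * s * r * s = r * s"
    unfolding outer_factors_cancel[OF a b] by (simp add: p_def s_def)
qed

theorem theorem3p2:
  fixes a b p q r s :: "'a::cstar_algebra"
  assumes "regular a" and "regular b" and "regular (a * b)"
    and "p = b * b\<^sup>\<dagger>"
    and "q = a\<^sup>\<dagger> * (a\<^sup>\<dagger>)\<^sup>\<star>"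
    and "r = b * b\<^sup>\<star>"
    and "s = a\<^sup>\<dagger> * a"
  shows "((a * b)\<^sup>\<dagger> = b\<^sup>\<dagger> * a\<^sup>\<dagger> \<longleftrightarrow>
            b\<^sup>\<dagger> * (q * p - p * q) * a\<^sup>\<star> = 0 \<and> b\<^sup>\<dagger> * (s * r - r * s) * a\<^sup>\<star> = 0)
       \<and> (b\<^sup>\<dagger> * (q * p - p * q) * a\<^sup>\<star> = 0 \<and> b\<^sup>\<dagger> * (s * r - r * s) * a\<^sup>\<star> = 0 \<longleftrightarrow>
            p * q * p * s = p * q \<and> p * s * r * s = r * s)"
proof -
  note a = regular_imp_mp_inverse[OF assms(1)] and b = regular_imp_mp_inverse[OF assms(2)]
  have "(a * b)\<^sup>\<dagger> = b\<^sup>\<dagger> * a\<^sup>\<dagger> \<longleftrightarrow> is_mp_inverse (a * b) (b\<^sup>\<dagger> * a\<^sup>\<dagger>)"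
    using regular_imp_mp_inverse[OF assms(3)] mp_inverse_eqI by metis
  also have "\<dots> \<longleftrightarrow> p * q * p * s = p * q \<and> p * s * r * s = r * s"
    unfolding assms(4-7) by (rule mp_inverse_mult_iff_products[OF a b])
  finally show ?thesis
    using commutator_form_iff[OF a b] unfolding assms(4-7) by simp
qed

end
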